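(* Let $0<p<1$, let $S_p$ be the transition operator of the stochastic adding machine in base $2$, acting by $v\mapsto S_p v$ on $\ell^1=\ell^1(\mathbb{N})$ (complex sequences viewed as column vectors), and let $J(f)$ be the filled Julia set of $f(z)=\dfrac{(z-(1-p))^2}{p^2}$. Then: (i) the point spectrum of $S_p$ on $\ell^1$ is empty; (ii) the residual spectrum $\sigma_r(S_p)$ of $S_p$ on $\ell^1$ is not empty and contains a countable dense subset of the Julia set $\partial J(f)$; namely, $\bigcup_{n=0}^{+\infty} f^{-n}(\{1\})$ is a countable dense subset of $\partial J(f)$ and $\bigcup_{n=0}^{+\infty} f^{-n}(\{1\})\subset\sigma_r(S_p)$; (iii) the continuous spectrum of $S_p$ on $\ell^1$ is equal to $J(f)\setminus\sigma_r(S_p)$.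
   Context: $\mathbb{N}=\{0,1,2,\dots\}$. The operator $S_p$ is given by the infinite matrix $((S_p)_{n,m})_{n,m\in\mathbb{N}}$ defined as follows: for $n\in\mathbb{N}$ let $s=s(n)\ge 0$ be the number of consecutive digits $1$ at the end (least significant positions) of the binary expansion of $n$, i.e. the largest $s$ such that $2^s$ divides $n+1$. Then $(S_p)_{n,n+1}=p^{s+1}$, $(S_p)_{n,\,n-2^m+1}=p^m(1-p)$ for $0\le m\le s$ (in particular $(S_p)_{n,n}=1-p$), and all other entries of row $n$ are $0$. It acts by $(S_pv)_n=\sum_{m}(S_p)_{n,m}v_m$, and defines a bounded operator on $\ell^1$. For a bounded operator $T$ on a complex Banach space $E$: the point spectrum is the set of $\lambda\in\mathbb{C}$ for which $T-\lambda\,\mathrm{Id}$ is not injective; the continuous spectrum is the set of $\lambda$ for which $T-\lambda\,\mathrm{Id}$ is injective, not onto, and has dense range; the residual spectrum is the set of $\lambda$ for which $T-\lambda\,\mathrm{Id}$ is injective and does not have dense range. The filled Julia set is $J(f)=\{z\in\mathbb{C}: (f^{n}(z))_{n\ge 0}\text{ is bounded}\}$, where $f^n$ is the $n$-th iterate of $f$; the Julia set is its topological boundary $\partial J(f)$ in $\mathbb{C}$. $f^{-n}(\{1\})$ denotes the preimage of $\{1\}$ under $f^n$. *)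

theory Defs
  imports "HOL-Analysis.Analysis" "HOL-Computational_Algebra.Primes"
begin

text \<open>Complex Banach spaces. The library only has real ones, so complex scalar multiplication is
  added on top of the class \<open>banach\<close>, compatibly with the real one.\<close>

class complex_banach = banach +
  fixes scaleC :: "complex \<Rightarrow> 'a \<Rightarrow> 'a" (infixr \<open>*\<^sub>C\<close> 75)
  assumes scaleC_add_right: "c *\<^sub>C (x + y) = c *\<^sub>C x + c *\<^sub>C y"
    and scaleC_add_left: "(c + d) *\<^sub>C x = c *\<^sub>C x + d *\<^sub>C x"
    and scaleC_scaleC: "c *\<^sub>C (d *\<^sub>C x) = (c * d) *\<^sub>C x"
    and scaleC_of_real: "of_real r *\<^sub>C x = r *\<^sub>R x"
    and norm_scaleC: "norm (c *\<^sub>C x) = cmod c * norm x"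

text \<open>The three parts of the spectrum, for \<open>T\<close> a bounded operator.\<close>

definition point_spectrum :: "('a::complex_banach \<Rightarrow> 'a) \<Rightarrow> complex set" where
  "point_spectrum T = {c. \<not> inj (\<lambda>x. T x - c *\<^sub>C x)}"

definition continuous_spectrum :: "('a::complex_banach \<Rightarrow> 'a) \<Rightarrow> complex set" where
  "continuous_spectrum T =
     {c. inj (\<lambda>x. T x - c *\<^sub>C x) \<and> \<not> surj (\<lambda>x. T x - c *\<^sub>C x) \<and>
         closure (range (\<lambda>x. T x - c *\<^sub>C x)) = UNIV}"

definition residual_spectrum :: "('a::complex_banach \<Rightarrow> 'a) \<Rightarrow> complex set" where
  "residual_spectrum T =
     {c. inj (\<lambda>x. T x - c *\<^sub>C x) \<and> closure (range (\<lambda>x. T x - c *\<^sub>C x)) \<noteq> UNIV}"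


text \<open>The space of absolutely summable complex sequences.\<close>

typedef ell1 = "{v :: nat \<Rightarrow> complex. summable (\<lambda>n. cmod (v n))}"
  morphisms ell1_nth Abs_ell1
  by (rule exI[of _ "\<lambda>_. 0"]) simp

setup_lifting type_definition_ell1

lemma summable_ell1_nth: "summable (\<lambda>n. cmod (ell1_nth v n))"
  using ell1_nth[of v] by simp

lemma ell1_eqI: "(\<And>n. ell1_nth v n = ell1_nth w n) \<Longrightarrow> v = w"
  by (metis ell1_nth_inject ext)

instantiation ell1 :: real_normed_vector
begin

lift_definition zero_ell1 :: ell1 is "\<lambda>_. 0"
  by simp

lift_definition plus_ell1 :: "ell1 \<Rightarrow> ell1 \<Rightarrow> ell1" is "\<lambda>v w n. v n + w n"
proof -
  fix v w :: "nat \<Rightarrow> complex"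
  assume *: "summable (\<lambda>n. cmod (v n))" "summable (\<lambda>n. cmod (w n))"
  show "summable (\<lambda>n. cmod (v n + w n))"
    by (rule summable_comparison_test'[OF summable_add[OF *]]) (simp add: norm_triangle_ineq)
qed

lift_definition uminus_ell1 :: "ell1 \<Rightarrow> ell1" is "\<lambda>v n. - v n"
  by simp

lift_definition minus_ell1 :: "ell1 \<Rightarrow> ell1 \<Rightarrow> ell1" is "\<lambda>v w n. v n - w n"
proof -
  fix v w :: "nat \<Rightarrow> complex"
  assume *: "summable (\<lambda>n. cmod (v n))" "summable (\<lambda>n. cmod (w n))"
  show "summable (\<lambda>n. cmod (v n - w n))"
    by (rule summable_comparison_test'[OF summable_add[OF *]]) (simp add: norm_triangle_ineq4)
qed

lift_definition scaleR_ell1 :: "real \<Rightarrow> ell1 \<Rightarrow> ell1" is "\<lambda>r v n. r *\<^sub>R v n"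
  by (simp add: summable_mult)

lift_definition norm_ell1 :: "ell1 \<Rightarrow> real" is "\<lambda>v. \<Sum>n. cmod (v n)" .

definition dist_ell1 :: "ell1 \<Rightarrow> ell1 \<Rightarrow> real" where
  "dist_ell1 v w = norm (v - w)"

definition sgn_ell1 :: "ell1 \<Rightarrow> ell1" where
  "sgn_ell1 v = inverse (norm v) *\<^sub>R v"

definition uniformity_ell1 :: "(ell1 \<times> ell1) filter" where
  "uniformity_ell1 = (INF e\<in>{0 <..}. principal {(x, y). dist x y < e})"

definition open_ell1 :: "ell1 set \<Rightarrow> bool" where
  "open_ell1 U = (\<forall>x\<in>U. eventually (\<lambda>(x', y). x' = x \<longrightarrow> y \<in> U) uniformity)"

instance
proof
  fix u v w :: ell1 and a b :: real
  show "u + v + w = u + (v + w)" by transfer (simp add: add.assoc)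
  show "u + v = v + u" by transfer (simp add: add.commute)
  show "0 + u = u" by transfer simp
  show "- u + u = 0" by transfer simp
  show "u - v = u + - v" by transfer simp
  show "a *\<^sub>R (u + v) = a *\<^sub>R u + a *\<^sub>R v" by transfer (simp add: algebra_simps)
  show "(a + b) *\<^sub>R u = a *\<^sub>R u + b *\<^sub>R u" by transfer (simp add: algebra_simps)
  show "a *\<^sub>R b *\<^sub>R u = (a * b) *\<^sub>R u" by transfer simp
  show "1 *\<^sub>R u = u" by transfer simp
  show "(norm u = 0) = (u = 0)"
    by transfer (auto simp: suminf_eq_zero_iff fun_eq_iff)
  show "norm (a *\<^sub>R u) = \<bar>a\<bar> * norm u"
    by transfer (simp add: suminf_mult)
  show "norm (u + v) \<le> norm u + norm v"
  proof transfer
    fix v w :: "nat \<Rightarrow> complex"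
    assume *: "summable (\<lambda>n. cmod (v n))" "summable (\<lambda>n. cmod (w n))"
    have "summable (\<lambda>n. cmod (v n + w n))"
      by (rule summable_comparison_test'[OF summable_add[OF *]]) (simp add: norm_triangle_ineq)
    then show "(\<Sum>n. cmod (v n + w n)) \<le> (\<Sum>n. cmod (v n)) + (\<Sum>n. cmod (w n))"
      using * by (subst suminf_add) (simp_all add: suminf_le summable_add norm_triangle_ineq)
  qed
qed (simp_all add: dist_ell1_def sgn_ell1_def uniformity_ell1_def open_ell1_def)

end

lemma norm_ell1_nth_le: "cmod (ell1_nth v n) \<le> norm v"
  using sum_le_suminf[OF summable_ell1_nth[of v], of "{n}"] by (simp add: norm_ell1.rep_eq)

lemma ell1_partial_sum_le: "(\<Sum>n<N. cmod (ell1_nth v n)) \<le> norm v"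
  using sum_le_suminf[OF summable_ell1_nth[of v], of "{..<N}"] by (simp add: norm_ell1.rep_eq)

instance ell1 :: banach
proof
  fix X :: "nat \<Rightarrow> ell1"
  assume X: "Cauchy X"
  have "convergent (\<lambda>i. ell1_nth (X i) n)" for n
  proof -
    have "Cauchy (\<lambda>i. ell1_nth (X i) n)"
    proof (rule metric_CauchyI)
      fix e :: real assume "0 < e"
      then obtain M where M: "\<And>i j. i \<ge> M \<Longrightarrow> j \<ge> M \<Longrightarrow> norm (X i - X j) < e"
        using CauchyD[OF X] by blast
      have "dist (ell1_nth (X i) n) (ell1_nth (X j) n) < e" if "i \<ge> M" "j \<ge> M" for i j
        using norm_ell1_nth_le[of "X i - X j" n] M[OF that]
        by (simp add: minus_ell1.rep_eq dist_norm)
      then show "\<exists>M. \<forall>i\<ge>M. \<forall>j\<ge>M. dist (ell1_nth (X i) n) (ell1_nth (X j) n) < e"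
        by blast
    qed
    then show ?thesis by (rule Cauchy_convergent)
  qed
  then obtain L where L: "\<And>n. (\<lambda>i. ell1_nth (X i) n) \<longlonglongrightarrow> L n"
    unfolding convergent_def by metis
  have tail: "\<exists>M. \<forall>i\<ge>M. \<forall>N. (\<Sum>n<N. cmod (ell1_nth (X i) n - L n)) \<le> e" if e: "0 < e" for e
  proof -
    obtain M where M: "\<And>i j. i \<ge> M \<Longrightarrow> j \<ge> M \<Longrightarrow> norm (X i - X j) < e"
      using CauchyD[OF X e] by blast
    have "(\<Sum>n<N. cmod (ell1_nth (X i) n - L n)) \<le> e" if "i \<ge> M" for i N
    proof (rule tendsto_upperbound)
      show "(\<lambda>j. \<Sum>n<N. cmod (ell1_nth (X i) n - ell1_nth (X j) n))
              \<longlonglongrightarrow> (\<Sum>n<N. cmod (ell1_nth (X i) n - L n))"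
        by (intro tendsto_intros L)
      show "\<forall>\<^sub>F j in sequentially. (\<Sum>n<N. cmod (ell1_nth (X i) n - ell1_nth (X j) n)) \<le> e"
        using eventually_ge_at_top[of M]
      proof eventually_elim
        case (elim j)
        then show ?case
          using ell1_partial_sum_le[of "X i - X j" N] M[OF \<open>i \<ge> M\<close> elim]
          by (simp add: minus_ell1.rep_eq)
      qed
    qed simp
    then show ?thesis by blast
  qed
  have summ: "summable (\<lambda>n. cmod (ell1_nth (X i) n - L n))"
    if "\<forall>N. (\<Sum>n<N. cmod (ell1_nth (X i) n - L n)) \<le> e" for i e
    using that by (intro summableI_nonneg_bounded[where x = e]) auto
  obtain i0 where i0: "summable (\<lambda>n. cmod (ell1_nth (X i0) n - L n))"
    using tail[of 1] summ by (meson order_refl zero_less_one)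
  have "summable (\<lambda>n. cmod (L n))"
  proof (rule summable_comparison_test'[OF summable_add[OF i0 summable_ell1_nth[of "X i0"]]])
    show "norm (cmod (L n)) \<le> cmod (ell1_nth (X i0) n - L n) + cmod (ell1_nth (X i0) n)" for n
      using norm_triangle_ineq4[of "ell1_nth (X i0) n" "ell1_nth (X i0) n - L n"] by simp
  qed
  then have nth_L: "ell1_nth (Abs_ell1 L) = L"
    by (simp add: Abs_ell1_inverse)
  have "X \<longlonglongrightarrow> Abs_ell1 L"
  proof (rule metric_LIMSEQ_I)
    fix r :: real assume "0 < r"
    then obtain M where M: "\<And>i. i \<ge> M \<Longrightarrow> \<forall>N. (\<Sum>n<N. cmod (ell1_nth (X i) n - L n)) \<le> r / 2"
      using tail[of "r / 2"] by auto
    have "dist (X i) (Abs_ell1 L) < r" if "i \<ge> M" for i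
    proof -
      have "dist (X i) (Abs_ell1 L) = (\<Sum>n. cmod (ell1_nth (X i) n - L n))"
        by (simp add: dist_norm norm_ell1.rep_eq minus_ell1.rep_eq nth_L)
      also have "\<dots> \<le> r / 2"
        using M[OF that] summ[OF M[OF that]] by (intro suminf_le_const) auto
      finally show ?thesis using \<open>0 < r\<close> by simp
    qed
    then show "\<exists>M. \<forall>i\<ge>M. dist (X i) (Abs_ell1 L) < r" by blast
  qed
  then show "convergent X" by (rule convergentI)
qed

instantiation ell1 :: complex_banach
begin

lift_definition scaleC_ell1 :: "complex \<Rightarrow> ell1 \<Rightarrow> ell1" is "\<lambda>c v n. c * v n"
  by (simp add: norm_mult summable_mult)

instance
proof
  fix c d :: complex and r :: real and x y :: ell1
  show "c *\<^sub>C (x + y) = c *\<^sub>C x + c *\<^sub>C y" by transfer (simp add: algebra_simps)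
  show "(c + d) *\<^sub>C x = c *\<^sub>C x + d *\<^sub>C x" by transfer (simp add: algebra_simps)
  show "c *\<^sub>C d *\<^sub>C x = (c * d) *\<^sub>C x" by transfer (simp add: mult.assoc)
  show "complex_of_real r *\<^sub>C x = r *\<^sub>R x" by transfer (simp add: scaleR_conv_of_real)
  show "norm (c *\<^sub>C x) = cmod c * norm x" by transfer (simp add: norm_mult suminf_mult)
qed

end


text \<open>\<open>trailing_ones n\<close> is the number of consecutive digits 1 at the end of the binary expansion
  of \<open>n\<close>, i.e. the largest \<open>s\<close> such that \<open>2 ^ s\<close> divides \<open>n + 1\<close>.\<close>

definition trailing_ones :: "nat \<Rightarrow> nat" where
  "trailing_ones n = multiplicity 2 (n + 1)"

text \<open>The transition matrix of the stochastic adding machine. The condition \<open>m = n - 2 ^ k + 1\<close>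
  is written without truncated subtraction; it holds for at most one \<open>k\<close>, so the sum has at most
  one nonzero term.\<close>

definition adding_machine_matrix :: "real \<Rightarrow> nat \<Rightarrow> nat \<Rightarrow> real" where
  "adding_machine_matrix p n m =
     (if m = n + 1 then p ^ (trailing_ones n + 1)
      else \<Sum>k\<le>trailing_ones n. if m + 2 ^ k = n + 1 then p ^ k * (1 - p) else 0)"

text \<open>For \<open>0 < p < 1\<close> the argument of \<open>Abs_ell1\<close> is absolutely summable, so this is the action of
  the matrix on column vectors; see \<open>ell1_nth_adding_machine\<close>,
  \<open>bounded_linear_adding_machine\<close> and \<open>adding_machine_scaleC\<close> below.\<close>

definition adding_machine :: "real \<Rightarrow> ell1 \<Rightarrow> ell1" where
  "adding_machine p v =
     Abs_ell1 (\<lambda>n. \<Sum>m. of_real (adding_machine_matrix p n m) * ell1_nth v m)"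

lemma adding_machine_matrix_nonneg:
  assumes "0 < p" "p < 1"
  shows "0 \<le> adding_machine_matrix p n m"
  using assms by (auto simp: adding_machine_matrix_def intro!: sum_nonneg)

lemma adding_machine_matrix_row_finite:
  assumes "m \<notin> {..n + 1}"
  shows "adding_machine_matrix p n m = 0"
  using assms by (auto simp: adding_machine_matrix_def intro!: sum.neutral)

lemma adding_machine_matrix_column_sum_le:
  assumes p: "0 < p" "p < 1"
  shows "(\<Sum>n<N. adding_machine_matrix p n m) \<le> 2"
proof -
  let ?a = "\<lambda>n. if m = n + 1 then (1::real) else 0"
  let ?b = "\<lambda>n k. if m + 2 ^ k = n + 1 then p ^ k * (1 - p) else 0"
  have le: "adding_machine_matrix p n m \<le> ?a n + (\<Sum>k<N. ?b n k)" if "n < N" for n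
  proof (cases "m = n + 1")
    case True
    then show ?thesis
      using p by (auto simp: adding_machine_matrix_def power_le_one intro!: mult_le_one)
  next
    case False
    have "?b n k = 0" if "k \<notin> {..<N}" for k
    proof -
      have "n + 1 \<le> k" using \<open>n < N\<close> that by simp
      also have "k < 2 ^ k" by (rule less_exp)
      finally have "n + 1 < 2 ^ k" .
      then show ?thesis by auto
    qed
    then have "(\<Sum>k\<le>trailing_ones n. ?b n k)
        = (\<Sum>k\<in>{..trailing_ones n} \<inter> {..<N}. ?b n k)"
      by (intro sum.mono_neutral_right) auto
    also have "\<dots> \<le> (\<Sum>k<N. ?b n k)"
      using p by (intro sum_mono2) auto
    finally show ?thesis
      using False by (simp add: adding_machine_matrix_def)
  qed
  have one_n: "(\<Sum>n<N. ?b n k) \<le> p ^ k * (1 - p)" for k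
  proof -
    have "(\<Sum>n<N. ?b n k) = (\<Sum>n\<in>{..<N} \<inter> {m + 2 ^ k - 1}. p ^ k * (1 - p))"
      by (intro sum.mono_neutral_cong_right) auto
    also have "\<dots> \<le> (\<Sum>n\<in>{m + 2 ^ k - 1}. p ^ k * (1 - p))"
      using p by (intro sum_mono2) auto
    finally show ?thesis by simp
  qed
  have "(\<Sum>n<N. adding_machine_matrix p n m) \<le> (\<Sum>n<N. ?a n + (\<Sum>k<N. ?b n k))"
    using le by (intro sum_mono) auto
  also have "\<dots> = (\<Sum>n<N. ?a n) + (\<Sum>n<N. \<Sum>k<N. ?b n k)"
    by (rule sum.distrib)
  also have "(\<Sum>n<N. \<Sum>k<N. ?b n k) = (\<Sum>k<N. \<Sum>n<N. ?b n k)"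
    by (rule sum.swap)
  also have "\<dots> \<le> (\<Sum>k<N. p ^ k * (1 - p))"
    by (intro sum_mono one_n)
  also have "(\<Sum>k<N. p ^ k * (1 - p)) = 1 - p ^ N"
    by (simp add: one_diff_power_eq sum_distrib_left mult.commute)
  also have "\<dots> \<le> 1"
    using p by simp
  also have "(\<Sum>n<N. ?a n) \<le> 1"
  proof -
    have "(\<Sum>n<N. ?a n) = (\<Sum>n\<in>{..<N} \<inter> {n. m = n + 1}. 1)"
      by (intro sum.mono_neutral_cong_right) auto
    also have "\<dots> \<le> (\<Sum>n\<in>{m - 1}. 1::real)"
      by (intro sum_mono2) auto
    finally show ?thesis by simp
  qed
  finally show ?thesis by simp
qed

lemma adding_machine_partial_sum_le:
  assumes p: "0 < p" "p < 1"
  shows "(\<Sum>n<N. cmod (\<Sum>m. of_real (adding_machine_matrix p n m) * ell1_nth v m)) \<le> 2 * norm v"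
proof -
  let ?A = "adding_machine_matrix p"
  have row: "cmod (\<Sum>m. of_real (?A n m) * ell1_nth v m) \<le> (\<Sum>m\<le>N. ?A n m * cmod (ell1_nth v m))"
    if "n < N" for n
  proof -
    have "(\<Sum>m. of_real (?A n m) * ell1_nth v m) = (\<Sum>m\<le>N. of_real (?A n m) * ell1_nth v m)"
      using that by (intro suminf_finite) (auto simp: adding_machine_matrix_row_finite)
    also have "cmod \<dots> \<le> (\<Sum>m\<le>N. cmod (of_real (?A n m) * ell1_nth v m))"
      by (rule norm_sum)
    also have "\<dots> = (\<Sum>m\<le>N. ?A n m * cmod (ell1_nth v m))"
      using adding_machine_matrix_nonneg[OF p] by (simp add: norm_mult)
    finally show ?thesis .
  qed
  have "(\<Sum>n<N. cmod (\<Sum>m. of_real (?A n m) * ell1_nth v m))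
      \<le> (\<Sum>n<N. \<Sum>m\<le>N. ?A n m * cmod (ell1_nth v m))"
    using row by (intro sum_mono) auto
  also have "\<dots> = (\<Sum>m\<le>N. (\<Sum>n<N. ?A n m) * cmod (ell1_nth v m))"
    by (subst sum.swap) (simp add: sum_distrib_right)
  also have "\<dots> \<le> (\<Sum>m\<le>N. 2 * cmod (ell1_nth v m))"
    by (intro sum_mono mult_right_mono adding_machine_matrix_column_sum_le p) auto
  also have "\<dots> = 2 * (\<Sum>m<Suc N. cmod (ell1_nth v m))"
    by (simp add: sum_distrib_left lessThan_Suc_atMost)
  also have "\<dots> \<le> 2 * norm v"
    by (intro mult_left_mono ell1_partial_sum_le) auto
  finally show ?thesis .
qed

lemma ell1_nth_adding_machine:
  assumes "0 < p" "p < 1"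
  shows "ell1_nth (adding_machine p v) n
    = (\<Sum>m. of_real (adding_machine_matrix p n m) * ell1_nth v m)"
proof -
  have "summable (\<lambda>n. cmod (\<Sum>m. of_real (adding_machine_matrix p n m) * ell1_nth v m))"
    by (rule summableI_nonneg_bounded[OF _ adding_machine_partial_sum_le[OF assms]]) simp
  then show ?thesis
    by (simp add: adding_machine_def Abs_ell1_inverse)
qed

lemma ell1_nth_adding_machine_finite:
  assumes "0 < p" "p < 1"
  shows "ell1_nth (adding_machine p v) n
    = (\<Sum>m\<le>n + 1. of_real (adding_machine_matrix p n m) * ell1_nth v m)"
  unfolding ell1_nth_adding_machine[OF assms]
  by (intro suminf_finite) (auto simp: adding_machine_matrix_row_finite)

lemma norm_adding_machine_le:
  assumes "0 < p" "p < 1"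
  shows "norm (adding_machine p v) \<le> 2 * norm v"
  unfolding norm_ell1.rep_eq[of "adding_machine p v"]
  using adding_machine_partial_sum_le[OF assms, of v] summable_ell1_nth[of "adding_machine p v"]
  by (intro suminf_le_const) (simp_all add: ell1_nth_adding_machine[OF assms])

lemma bounded_linear_adding_machine:
  assumes "0 < p" "p < 1"
  shows "bounded_linear (adding_machine p)"
proof (rule bounded_linear_intro)
  show "adding_machine p (v + w) = adding_machine p v + adding_machine p w" for v w
    by (rule ell1_eqI)
      (simp only: ell1_nth_adding_machine_finite[OF assms] plus_ell1.rep_eq distrib_left sum.distrib)
  show "adding_machine p (r *\<^sub>R v) = r *\<^sub>R adding_machine p v" for r v
    by (rule ell1_eqI)
      (simp only: ell1_nth_adding_machine_finite[OF assms] scaleR_ell1.rep_eq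
        mult_scaleR_right scaleR_right.sum)
  show "norm (adding_machine p v) \<le> norm v * 2" for v
    using norm_adding_machine_le[OF assms, of v] by (simp add: mult.commute)
qed

lemma adding_machine_scaleC:
  assumes "0 < p" "p < 1"
  shows "adding_machine p (c *\<^sub>C v) = c *\<^sub>C adding_machine p v"
  by (rule ell1_eqI)
    (simp only: ell1_nth_adding_machine_finite[OF assms] scaleC_ell1.rep_eq
      sum_distrib_left mult.left_commute)


definition filled_julia :: "(complex \<Rightarrow> complex) \<Rightarrow> complex set" where
  "filled_julia f = {z. bounded (range (\<lambda>n. (f ^^ n) z))}"

definition julia :: "(complex \<Rightarrow> complex) \<Rightarrow> complex set" where
  "julia f = frontier (filled_julia f)"

end

theory Submission
  imports Defs "HOL-Complex_Analysis.Great_Picard"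
begin

text \<open>Everything rests on a self-similarity. With \<open>q(z) = (z - (1 - p)) / p\<close>, so that
  \<open>f(z) = q(z)\<^sup>2\<close>, the operator \<open>q(S)\<close> maps a sequence with even part \<open>x\<close> and odd part \<open>y\<close> to the
  one with even part \<open>y\<close> and odd part \<open>S x\<close>; hence \<open>f(S)\<close> is \<open>S\<close> on each part. Solving
  \<open>(S - c) v = g\<close> is thereby equivalent to solving an equation with \<open>S - f(c)\<close> for the even part.
  Iterating this gives \<open>v (2 ^ n) = q(f\<^sup>n c) v 0\<close> for an eigenvector, and \<open>q(f\<^sup>n c)\<close> cannot tend to 0; it
  transports surjectivity from \<open>f\<^sup>n c\<close>, where the Neumann series applies once \<open>\<bar>f\<^sup>n c\<bar> > 2\<close>, to \<open>c\<close>;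
  and it lifts the invariant functional \<open>v \<mapsto> \<Sum>n. v n\<close> at \<open>c = 1\<close> to all iterated preimages of \<open>1\<close>.
  Density of these preimages in the Julia set follows from Schottky's theorem.\<close>

section \<open>Even and odd subsequences\<close>

lift_definition even_part :: "ell1 \<Rightarrow> ell1" is "\<lambda>v k. v (2 * k)"
  by (rule summable_reindex[where g = "\<lambda>k. 2 * k", unfolded o_def]) (auto intro: injI)

lift_definition odd_part :: "ell1 \<Rightarrow> ell1" is "\<lambda>v k. v (2 * k + 1)"
  by (rule summable_reindex[where g = "\<lambda>k. 2 * k + 1", unfolded o_def]) (auto intro: injI)

lift_definition interleave :: "ell1 \<Rightarrow> ell1 \<Rightarrow> ell1" is
  "\<lambda>u w n. if even n then u (n div 2) else w (n div 2)"
proof -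
  fix u w :: "nat \<Rightarrow> complex"
  assume "summable (\<lambda>n. cmod (u n))" "summable (\<lambda>n. cmod (w n))"
  \<comment> \<open>\<open>sums_if\<close> produces the index \<open>(n - 1) div 2\<close> at odd
    positions, which equals \<open>n div 2\<close> there.\<close>
  then have "summable (\<lambda>n. if even n then cmod (u (n div 2)) else cmod (w ((n - 1) div 2)))"
    using sums_if unfolding summable_def by blast
  then show "summable (\<lambda>n. cmod (if even n then u (n div 2) else w (n div 2)))"
    by (rule summable_cong[THEN iffD1, rotated]) (auto elim!: oddE intro!: always_eventually)
qed

lemma even_part_interleave [simp]: "even_part (interleave u w) = u"
  by transfer auto

lemma odd_part_interleave [simp]: "odd_part (interleave u w) = w"
  by transfer auto

lemma scaleC_diff_right: "c *\<^sub>C (v - w) = c *\<^sub>C v - c *\<^sub>C (w :: ell1)"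
  by transfer (simp add: algebra_simps)

lemma ell1_eq_iff_parts:
  "v = w \<longleftrightarrow> (\<forall>k. ell1_nth v (2 * k) = ell1_nth w (2 * k)
                \<and> ell1_nth v (2 * k + 1) = ell1_nth w (2 * k + 1))"
proof
  assume *: "\<forall>k. ell1_nth v (2 * k) = ell1_nth w (2 * k)
                \<and> ell1_nth v (2 * k + 1) = ell1_nth w (2 * k + 1)"
  show "v = w"
  proof (rule ell1_eqI)
    show "ell1_nth v n = ell1_nth w n" for n
      using * by (cases "even n") (auto elim!: evenE oddE)
  qed
qed simp

lemma norm_even_part_le: "norm (even_part v) \<le> norm v"
  unfolding norm_ell1.rep_eq even_part.rep_eq
  by (rule suminf_reindex_mono[where g = "\<lambda>k. 2 * k", unfolded o_def])
    (auto intro: injI summable_ell1_nth)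

lemma norm_odd_part_le: "norm (odd_part v) \<le> norm v"
  unfolding norm_ell1.rep_eq odd_part.rep_eq
  by (rule suminf_reindex_mono[where g = "\<lambda>k. 2 * k + 1", unfolded o_def])
    (auto intro: injI summable_ell1_nth)

lemma bounded_linear_even_part: "bounded_linear even_part"
proof (rule bounded_linear_intro[where K = 1])
  show "norm (even_part v) \<le> norm v * 1" for v
    by (simp add: norm_even_part_le)
qed (transfer, simp)+

lemma bounded_linear_odd_part: "bounded_linear odd_part"
proof (rule bounded_linear_intro[where K = 1])
  show "norm (odd_part v) \<le> norm v * 1" for v
    by (simp add: norm_odd_part_le)
qed (transfer, simp)+

lemma even_part_scaleC [simp]: "even_part (c *\<^sub>C v) = c *\<^sub>C even_part v"
  by transfer simp

lemma odd_part_scaleC [simp]: "odd_part (c *\<^sub>C v) = c *\<^sub>C odd_part v"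
  by transfer simp

lemma funpow_even_part_nth: "ell1_nth ((even_part ^^ n) v) k = ell1_nth v (2 ^ n * k)"
  by (induction n arbitrary: k) (simp_all add: even_part.rep_eq mult.assoc mult.left_commute)

section \<open>Self-similarity of the adding machine\<close>

definition affine_part :: "real \<Rightarrow> complex \<Rightarrow> complex" where
  "affine_part p z = (z - (1 - of_real p)) / of_real p"

definition quad_map :: "real \<Rightarrow> complex \<Rightarrow> complex" where
  "quad_map p z = (affine_part p z)\<^sup>2"

lemma trailing_ones_double: "trailing_ones (2 * k) = 0"
  unfolding trailing_ones_def by (rule not_dvd_imp_multiplicity_0) simp

lemma trailing_ones_double_plus1: "trailing_ones (2 * k + 1) = Suc (trailing_ones k)"
proof -
  have "2 * k + 1 + 1 = 2 * (k + 1)" by simp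
  then show ?thesis
    unfolding trailing_ones_def by (simp only:) (rule multiplicity_times_same, auto)
qed

locale stochastic_adding_machine =
  fixes p :: real
  assumes p_pos: "0 < p" and p_less_1: "p < 1"
begin

abbreviation S :: "ell1 \<Rightarrow> ell1" where "S \<equiv> adding_machine p"

abbreviation q :: "complex \<Rightarrow> complex" where "q \<equiv> affine_part p"

abbreviation f :: "complex \<Rightarrow> complex" where "f \<equiv> quad_map p"

sublocale S: bounded_linear S
  by (rule bounded_linear_adding_machine[OF p_pos p_less_1])

sublocale E: bounded_linear even_part
  by (rule bounded_linear_even_part)

sublocale O: bounded_linear odd_part
  by (rule bounded_linear_odd_part)

lemma ell1_nth_S:
  "ell1_nth (S v) n = of_real (p ^ (trailing_ones n + 1)) * ell1_nth v (n + 1)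
     + (\<Sum>k\<le>trailing_ones n. of_real (p ^ k * (1 - p)) * ell1_nth v (n + 1 - 2 ^ k))"
proof -
  let ?b = "\<lambda>m k. if m + 2 ^ k = n + 1 then p ^ k * (1 - p) else 0"
  let ?v = "ell1_nth v"
  \<comment> \<open>For \<open>m = n + 1\<close> no \<open>k\<close> satisfies
    \<open>m + 2 ^ k = n + 1\<close>, so the case distinction in the matrix can be written as a sum
    of both branches.\<close>
  have split: "of_real (adding_machine_matrix p n m) * ?v m =
      (if m = n + 1 then of_real (p ^ (trailing_ones n + 1)) * ?v m else 0)
      + (\<Sum>k\<le>trailing_ones n. of_real (?b m k) * ?v m)" for m
    by (auto simp: adding_machine_matrix_def sum_distrib_right)
  have "(\<Sum>m\<le>n + 1. of_real (?b m k) * ?v m) = of_real (p ^ k * (1 - p)) * ?v (n + 1 - 2 ^ k)"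
    if "k \<le> trailing_ones n" for k
  proof -
    \<comment> \<open>Divisibility makes the truncated subtraction \<open>n + 1 - 2 ^ k\<close>
      exact.\<close>
    have "2 ^ k dvd n + 1"
      using that multiplicity_dvd'[of k 2 "n + 1"] by (simp add: trailing_ones_def)
    then have le: "2 ^ k \<le> n + 1"
      by (rule dvd_imp_le) simp
    have "(\<Sum>m\<le>n + 1. of_real (?b m k) * ?v m)
        = (\<Sum>m\<in>{n + 1 - 2 ^ k}. of_real (?b m k) * ?v m)"
      by (rule sum.mono_neutral_right) auto
    with le show ?thesis by simp
  qed
  then have "(\<Sum>m\<le>n + 1. \<Sum>k\<le>trailing_ones n. of_real (?b m k) * ?v m)
      = (\<Sum>k\<le>trailing_ones n. of_real (p ^ k * (1 - p)) * ?v (n + 1 - 2 ^ k))"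
    by (subst sum.swap) (auto intro: sum.cong)
  then show ?thesis
    unfolding ell1_nth_adding_machine_finite[OF p_pos p_less_1] split sum.distrib
    by (simp add: sum.delta)
qed

lemma even_part_S: "even_part (S v) = of_real (1 - p) *\<^sub>C even_part v + of_real p *\<^sub>C odd_part v"
  by (rule ell1_eqI)
    (simp add: even_part.rep_eq odd_part.rep_eq plus_ell1.rep_eq scaleC_ell1.rep_eq
      ell1_nth_S trailing_ones_double)

text \<open>At \<open>2 * k + 1\<close> the last digit is 1: with probability \<open>1 - p\<close>
  the machine stops at once (the summand \<open>k = 0\<close> of \<open>ell1_nth_S\<close>), and
  with probability \<open>p\<close> it carries and then acts on the remaining digits as on
  \<open>k\<close>.\<close>

lemma odd_part_S: "odd_part (S v) = of_real (1 - p) *\<^sub>C odd_part v + of_real p *\<^sub>C S (even_part v)"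
proof (rule ell1_eqI)
  fix k
  let ?t = "trailing_ones k" and ?v = "ell1_nth v"
  have "2 * k + 1 + 1 - 2 ^ Suc i = 2 * (k + 1 - 2 ^ i)" for i
    by simp
  then have "ell1_nth (S v) (2 * k + 1) = of_real (p ^ (?t + 2)) * ?v (2 * (k + 1))
      + (of_real (1 - p) * ?v (2 * k + 1)
         + (\<Sum>i\<le>?t. of_real (p ^ Suc i * (1 - p)) * ?v (2 * (k + 1 - 2 ^ i))))"
    by (simp only: ell1_nth_S[of v "2 * k + 1"] trailing_ones_double_plus1 sum.atMost_Suc_shift)
      simp
  also have "\<dots> = of_real (1 - p) * ?v (2 * k + 1) + of_real p * ell1_nth (S (even_part v)) k"
    by (simp add: ell1_nth_S[of "even_part v" k] even_part.rep_eq sum_distrib_left algebra_simps)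
  finally show "ell1_nth (odd_part (S v)) k
      = ell1_nth (of_real (1 - p) *\<^sub>C odd_part v + of_real p *\<^sub>C S (even_part v)) k"
    by (simp add: odd_part.rep_eq plus_ell1.rep_eq scaleC_ell1.rep_eq)
qed

text \<open>The even rows of the equation express the odd part of \<open>v\<close> through its even
  part. Substituting this into the odd rows eliminates the odd part, and the factor
  \<open>(q c)\<^sup>2\<close> that arises is \<open>f c\<close>.\<close>

lemma resolvent_eq_iff_parts:
  "S v - c *\<^sub>C v = g \<longleftrightarrow>
     odd_part v = q c *\<^sub>C even_part v + (1 / of_real p) *\<^sub>C even_part g
     \<and> S (even_part v) - f c *\<^sub>C even_part v
         = (1 / of_real p) *\<^sub>C (odd_part g + q c *\<^sub>C even_part g)"
proof -
  have c: "c = 1 - of_real p + of_real p * q c"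
    using p_pos by (simp add: affine_part_def)
  have E: "ell1_nth (S v) (2 * k)
      = of_real (1 - p) * ell1_nth v (2 * k) + of_real p * ell1_nth v (2 * k + 1)" for k
    using arg_cong[OF even_part_S, of "\<lambda>u. ell1_nth u k" v]
    by (simp add: odd_part.rep_eq even_part.rep_eq plus_ell1.rep_eq scaleC_ell1.rep_eq)
  have O: "ell1_nth (S v) (2 * k + 1)
      = of_real (1 - p) * ell1_nth v (2 * k + 1) + of_real p * ell1_nth (S (even_part v)) k" for k
    using arg_cong[OF odd_part_S, of "\<lambda>u. ell1_nth u k" v]
    by (simp add: odd_part.rep_eq even_part.rep_eq plus_ell1.rep_eq scaleC_ell1.rep_eq)
  \<comment> \<open>The elimination for a single index: \<open>x\<close>, \<open>y\<close>,
    \<open>s\<close> stand for entries of the even part, of the odd part and of \<open>S\<close>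
    applied to the even part, and \<open>a\<close> for \<open>q c\<close>.\<close>
  have alg: "(1 - P) * x + P * y - (1 - P + P * a) * x = g0 \<and>
      (1 - P) * y + P * s - (1 - P + P * a) * y = g1
      \<longleftrightarrow> y = a * x + 1 / P * g0 \<and> s - a\<^sup>2 * x = 1 / P * (g1 + a * g0)"
    if "P \<noteq> 0" for P x y a g0 g1 s :: complex
  proof -
    have "(1 - P) * x + P * y - (1 - P + P * a) * x = g0 \<longleftrightarrow> y = a * x + 1 / P * g0"
      using that by (auto simp: field_simps)
    moreover have "(1 - P) * y + P * s - (1 - P + P * a) * y = g1
        \<longleftrightarrow> s - a\<^sup>2 * x = 1 / P * (g1 + a * g0)" if "y = a * x + 1 / P * g0"
    proof -
      have "P * y = P * (a * x) + g0"
        using \<open>P \<noteq> 0\<close> that by (simp add: field_simps)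
      then have "a * (P * y) = P * (a\<^sup>2 * x) + a * g0"
        by (simp add: algebra_simps power2_eq_square)
      then have "(1 - P) * y + P * s - (1 - P + P * a) * y = P * (s - a\<^sup>2 * x) - a * g0"
        by (simp add: algebra_simps)
      then show ?thesis
        using \<open>P \<noteq> 0\<close> by (auto simp: field_simps)
    qed
    ultimately show ?thesis by blast
  qed
  have ext: "u = w \<longleftrightarrow> (\<forall>k. ell1_nth u k = ell1_nth w k)" for u w
    using ell1_eqI by auto
  have "S v - c *\<^sub>C v = g \<longleftrightarrow> (\<forall>k.
      (1 - of_real p) * ell1_nth v (2 * k) + of_real p * ell1_nth v (2 * k + 1)
        - (1 - of_real p + of_real p * q c) * ell1_nth v (2 * k) = ell1_nth g (2 * k) \<and>
      (1 - of_real p) * ell1_nth v (2 * k + 1) + of_real p * ell1_nth (S (even_part v)) k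
        - (1 - of_real p + of_real p * q c) * ell1_nth v (2 * k + 1) = ell1_nth g (2 * k + 1))"
    unfolding ell1_eq_iff_parts minus_ell1.rep_eq scaleC_ell1.rep_eq E O c[symmetric]
    by simp
  also have "\<dots> \<longleftrightarrow> (\<forall>k.
      ell1_nth v (2 * k + 1) = q c * ell1_nth v (2 * k) + 1 / of_real p * ell1_nth g (2 * k) \<and>
      ell1_nth (S (even_part v)) k - (q c)\<^sup>2 * ell1_nth v (2 * k)
        = 1 / of_real p * (ell1_nth g (2 * k + 1) + q c * ell1_nth g (2 * k)))"
    using p_pos by (subst alg) auto
  finally show ?thesis
    unfolding ext minus_ell1.rep_eq plus_ell1.rep_eq scaleC_ell1.rep_eq odd_part.rep_eq
      even_part.rep_eq quad_map_def by blast
qed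

lemma affine_part_recursion: "q (f c) = ((q c)\<^sup>2 - (1 - of_real p)) / of_real p"
  by (simp add: affine_part_def quad_map_def)

section \<open>Injectivity\<close>

lemma eigenvector_even_part:
  assumes "S v = c *\<^sub>C v"
  shows "odd_part v = q c *\<^sub>C even_part v" "S (even_part v) = f c *\<^sub>C even_part v"
proof -
  have "c *\<^sub>C (0 :: ell1) = 0" for c
    by transfer simp
  then show "odd_part v = q c *\<^sub>C even_part v" "S (even_part v) = f c *\<^sub>C even_part v"
    using resolvent_eq_iff_parts[of v c 0] assms by (simp_all add: E.zero O.zero)
qed

lemma eigenvector_funpow:
  assumes "S v = c *\<^sub>C v"
  shows "S ((even_part ^^ n) v) = (f ^^ n) c *\<^sub>C (even_part ^^ n) v"
  using assms by (induction n) (simp_all add: eigenvector_even_part)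

lemma eigenvector_nth_1:
  assumes "S v = c *\<^sub>C v"
  shows "ell1_nth v 1 = q c * ell1_nth v 0"
  using arg_cong[OF eigenvector_even_part(1)[OF assms], of "\<lambda>u. ell1_nth u 0"]
  by (simp add: odd_part.rep_eq even_part.rep_eq scaleC_ell1.rep_eq)

text \<open>Each entry at \<open>n\<close> is a multiple of the entry at \<open>n div 2\<close> of
  the even part, which is again annihilated by some \<open>S - c'\<close> and starts with 0. The
  value \<open>c\<close> changes to \<open>f c\<close>, so the induction generalises over
  it.\<close>

lemma eigenvector_nth_zero:
  assumes "S v = c *\<^sub>C v" "ell1_nth v 0 = 0"
  shows "ell1_nth v n = 0"
  using assms
proof (induction n arbitrary: v c rule: less_induct)
  case (less n)
  let ?w = "even_part v"
  have w: "S ?w = f c *\<^sub>C ?w" "ell1_nth ?w 0 = 0"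
    using eigenvector_even_part(2) less.prems by (auto simp: even_part.rep_eq)
  show ?case
  proof (cases "even n")
    case True
    show ?thesis
    proof (cases "n = 0")
      case False
      then have "ell1_nth ?w (n div 2) = 0"
        using True by (intro less.IH[OF _ w]) auto
      with True show ?thesis by (simp add: even_part.rep_eq)
    qed (use less.prems in simp)
  next
    case False
    then have "ell1_nth ?w (n div 2) = 0"
      by (intro less.IH[OF _ w]) (auto elim!: oddE)
    then have "ell1_nth (odd_part v) (n div 2) = 0"
      by (simp add: eigenvector_even_part(1)[OF less.prems(1)] scaleC_ell1.rep_eq)
    with False show ?thesis by (simp add: odd_part.rep_eq)
  qed
qed

lemma ell1_nth_power2_tendsto_0: "(\<lambda>n. ell1_nth v (2 ^ n)) \<longlonglongrightarrow> 0"
proof -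
  have "ell1_nth v \<longlonglongrightarrow> 0"
    using summable_LIMSEQ_zero[OF summable_ell1_nth[of v]] tendsto_norm_zero_iff by blast
  moreover have "strict_mono (\<lambda>n. 2 ^ n :: nat)"
    by (auto intro: strict_monoI)
  ultimately show ?thesis
    using LIMSEQ_subseq_LIMSEQ[of "ell1_nth v" 0 "\<lambda>n. 2 ^ n"] by (simp add: o_def)
qed

lemma no_eigenvector:
  assumes "S v = c *\<^sub>C v"
  shows "v = 0"
proof -
  let ?Q = "\<lambda>n. q ((f ^^ n) c)"
  have v: "ell1_nth v (2 ^ n) = ?Q n * ell1_nth v 0" for n
    using eigenvector_nth_1[OF eigenvector_funpow[OF assms, of n]]
    by (simp add: funpow_even_part_nth)
  have "ell1_nth v 0 = 0"
  proof (rule ccontr)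
    assume nz: "ell1_nth v 0 \<noteq> 0"
    have "(\<lambda>n. ell1_nth v (2 ^ n) / ell1_nth v 0) \<longlonglongrightarrow> 0 / ell1_nth v 0"
      using nz by (intro tendsto_intros ell1_nth_power2_tendsto_0)
    then have Q: "?Q \<longlonglongrightarrow> 0"
      using nz by (simp add: v)
    \<comment> \<open>The values \<open>?Q n\<close> obey a quadratic recursion, so their limit 0
      would have to be a fixed point of it. This forces \<open>p = 1\<close>.\<close>
    have "(\<lambda>n. ((?Q n)\<^sup>2 - (1 - of_real p)) / of_real p) \<longlonglongrightarrow> (0\<^sup>2 - (1 - of_real p)) / of_real p"
      using p_pos by (intro tendsto_intros Q) auto
    moreover have "((?Q n)\<^sup>2 - (1 - of_real p)) / of_real p = ?Q (Suc n)" for n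
      by (simp add: affine_part_recursion)
    ultimately have "(\<lambda>n. ?Q (Suc n)) \<longlonglongrightarrow> (0\<^sup>2 - (1 - of_real p)) / of_real p"
      by (simp only:)
    with LIMSEQ_Suc[OF Q] have "(0\<^sup>2 - (1 - of_real p)) / of_real p = (0 :: complex)"
      by (metis LIMSEQ_unique)
    then have "complex_of_real p = of_real 1"
      using p_pos by simp
    then show False
      using p_less_1 unfolding of_real_eq_iff by simp
  qed
  then show ?thesis
    using eigenvector_nth_zero[OF assms] by (intro ell1_eqI) (simp add: zero_ell1.rep_eq)
qed

lemma inj_resolvent: "inj (\<lambda>v. S v - c *\<^sub>C v)"
proof (rule injI)
  fix v w assume eq: "S v - c *\<^sub>C v = S w - c *\<^sub>C w"
  have "c *\<^sub>C (v - w) = c *\<^sub>C v - c *\<^sub>C w"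
    by (rule scaleC_diff_right)
  also have "\<dots> = S v - S w"
  proof -
    have "x - y = a - b" if "a - x = b - y" for a b x y :: ell1
      using that by (simp add: algebra_simps)
    with eq show ?thesis by blast
  qed
  finally have "S (v - w) = c *\<^sub>C (v - w)"
    by (simp only: S.diff[symmetric])
  from no_eigenvector[OF this] show "v = w"
    by simp
qed

section \<open>Surjectivity off the filled Julia set\<close>

lemma surj_resolvent_of_large:
  assumes "2 < cmod c"
  shows "surj (\<lambda>v. S v - c *\<^sub>C v)"
  unfolding surj_def
proof
  fix g
  \<comment> \<open>Solutions are the fixed points of \<open>?T\<close>, a contraction because
    \<open>S\<close> has norm at most 2.\<close>
  let ?T = "\<lambda>v. (1 / c) *\<^sub>C (S v - g)"
  have dist: "dist (?T v) (?T w) \<le> 2 / cmod c * dist v w" for v w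
  proof -
    have "?T v - ?T w = (1 / c) *\<^sub>C S (v - w)"
      by (simp add: S.diff flip: scaleC_diff_right)
    then have "dist (?T v) (?T w) = norm (S (v - w)) / cmod c"
      unfolding dist_norm by (simp only: norm_scaleC) (simp add: norm_divide)
    also have "\<dots> \<le> (2 * norm (v - w)) / cmod c"
      by (intro divide_right_mono norm_adding_machine_le p_pos p_less_1) simp
    finally show ?thesis by (simp add: dist_norm)
  qed
  have "2 / cmod c < 1"
    using assms by (subst pos_divide_less_eq) linarith+
  then have "\<exists>!v. ?T v = v"
    using dist by (intro banach_fix_type[of "2 / cmod c"]) auto
  then obtain v where "?T v = v" by blast
  then have "c *\<^sub>C v = c *\<^sub>C ?T v" by (simp only:)
  also have "c *\<^sub>C ?T v = S v - g"
  proof -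
    have "c \<noteq> 0" using assms by auto
    then show ?thesis
      using scaleC_of_real[of 1 "S v - g"] by (simp add: scaleC_scaleC)
  qed
  finally show "\<exists>v. g = S v - c *\<^sub>C v"
    by (intro exI[of _ v]) simp
qed

lemma surj_resolvent_of_quad_map:
  assumes "surj (\<lambda>v. S v - f c *\<^sub>C v)"
  shows "surj (\<lambda>v. S v - c *\<^sub>C v)"
  unfolding surj_def
proof
  fix g
  obtain w where w: "(1 / of_real p) *\<^sub>C (odd_part g + q c *\<^sub>C even_part g) = S w - f c *\<^sub>C w"
    using surjD[OF assms, of "(1 / of_real p) *\<^sub>C (odd_part g + q c *\<^sub>C even_part g)"] by (rule exE)
  let ?v = "interleave w (q c *\<^sub>C w + (1 / of_real p) *\<^sub>C even_part g)"
  have "S ?v - c *\<^sub>C ?v = g"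
    by (rule resolvent_eq_iff_parts[THEN iffD2]) (simp add: w)
  from this[symmetric] show "\<exists>v. g = S v - c *\<^sub>C v"
    by (rule exI[where x = ?v])
qed

lemma surj_resolvent:
  assumes "c \<notin> filled_julia f"
  shows "surj (\<lambda>v. S v - c *\<^sub>C v)"
proof -
  obtain n where "2 < cmod ((f ^^ n) c)"
    using assms unfolding filled_julia_def bounded_iff by (auto simp: not_le)
  then have "surj (\<lambda>v. S v - (f ^^ n) c *\<^sub>C v)"
    by (rule surj_resolvent_of_large)
  then show ?thesis
    by (induction n) (simp_all add: surj_resolvent_of_quad_map)
qed

section \<open>Failure of surjectivity on the filled Julia set\<close>

text \<open>The coefficients are chosen such that a solution \<open>v\<close> of \<open>S v - c v = g\<close>, where \<open>g\<close> has the
  entry \<open>source_coeff c n\<close> at position \<open>2 ^ n - 1\<close>, satisfies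
  \<open>v (2 ^ n) = q (f\<^sup>n c) v 0 + n\<close>; this is unbounded when the orbit of \<open>c\<close> is bounded.
  For \<open>n = 0\<close> both truncated predecessors are harmless, since their product term is 0.\<close>

definition source_coeff :: "complex \<Rightarrow> nat \<Rightarrow> complex" where
  "source_coeff c n = of_real (p ^ (n + 1)) * of_nat n
     - of_real (p ^ n) * q ((f ^^ (n - 1)) c) * of_nat (n - 1)"

lemma bounded_affine_orbit:
  assumes "c \<in> filled_julia f"
  obtains Q where "0 \<le> Q" "\<And>n. cmod (q ((f ^^ n) c)) \<le> Q"
proof -
  obtain B where B: "\<And>n. cmod ((f ^^ n) c) \<le> B"
    using assms unfolding filled_julia_def bounded_iff by auto
  let ?Q = "(B + cmod (1 - of_real p)) / p"
  have Q: "cmod (q ((f ^^ n) c)) \<le> ?Q" for n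
  proof -
    have "cmod ((f ^^ n) c - (1 - of_real p)) \<le> B + cmod (1 - of_real p)"
      using B[of n] norm_triangle_ineq4[of "(f ^^ n) c" "1 - of_real p"] by linarith
    then show ?thesis
      using p_pos by (simp add: affine_part_def norm_divide divide_right_mono)
  qed
  show thesis
  proof (rule that)
    show "0 \<le> ?Q"
      using order_trans[OF norm_ge_zero Q[of 0]] .
  qed (rule Q)
qed

text \<open>The factor \<open>q\<close> is bounded along the orbit, so the coefficients are
  dominated by a multiple of the differentiated geometric series in \<open>p\<close>.\<close>

lemma summable_source_coeff:
  assumes "c \<in> filled_julia f"
  shows "summable (\<lambda>n. cmod (source_coeff c n))"
proof -
  obtain Q where Q: "0 \<le> Q" "\<And>n. cmod (q ((f ^^ n) c)) \<le> Q"
    using bounded_affine_orbit[OF assms] by metis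
  have "summable (\<lambda>n. (p + Q) * (real (Suc n) * p ^ n))"
    using geometric_deriv_sums[of p] p_pos p_less_1
    by (intro summable_mult) (auto simp: sums_iff)
  then show ?thesis
  proof (rule summable_comparison_test')
    fix n
    have "cmod (source_coeff c n)
        \<le> cmod (of_real (p ^ (n + 1)) * of_nat n)
          + cmod (of_real (p ^ n) * q ((f ^^ (n - 1)) c) * of_nat (n - 1))"
      unfolding source_coeff_def by (rule norm_triangle_ineq4)
    also have "\<dots> = p ^ (n + 1) * real n + p ^ n * cmod (q ((f ^^ (n - 1)) c)) * real (n - 1)"
      using p_pos by (simp add: norm_mult norm_power)
    also have "\<dots> \<le> p ^ (n + 1) * real (Suc n) + p ^ n * Q * real (Suc n)"
      using p_pos Q by (intro add_mono mult_mono) auto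
    finally show "norm (cmod (source_coeff c n)) \<le> (p + Q) * (real (Suc n) * p ^ n)"
      by (simp add: algebra_simps)
  qed
qed

lemma exists_source:
  assumes "c \<in> filled_julia f"
  shows "\<exists>g. (\<forall>n. ell1_nth g (2 ^ n - 1) = source_coeff c n)
    \<and> (\<forall>k. (\<forall>n. k \<noteq> 2 ^ n - 1) \<longrightarrow> ell1_nth g k = 0)"
proof -
  define e :: "nat \<Rightarrow> nat" where "e n = 2 ^ n - 1" for n
  have e: "strict_mono e"
    unfolding e_def by (intro strict_monoI diff_less_mono) auto
  then have inj: "inj e"
    by (rule strict_mono_imp_inj_on)
  define g where "g k = (if k \<in> range e then source_coeff c (inv e k) else 0)" for k
  have ge: "g (e n) = source_coeff c n" for n
    by (simp add: g_def inv_f_f[OF inj])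
  have "summable (\<lambda>n. cmod (g (e n)))"
    by (simp add: ge summable_source_coeff[OF assms])
  then have "summable (\<lambda>k. cmod (g k))"
    by (subst (asm) summable_mono_reindex[OF e]) (auto simp: g_def)
  then have nth: "ell1_nth (Abs_ell1 g) = g"
    by (simp add: Abs_ell1_inverse)
  show ?thesis
  proof (intro exI[of _ "Abs_ell1 g"] conjI allI impI)
    show "ell1_nth (Abs_ell1 g) (2 ^ n - 1) = source_coeff c n" for n
      using ge[of n] by (simp add: nth e_def)
    show "ell1_nth (Abs_ell1 g) k = 0" if "\<forall>n. k \<noteq> 2 ^ n - 1" for k
      using that by (auto simp: nth g_def e_def)
  qed
qed

text \<open>Passing from \<open>h\<close> to the right-hand side for the even part moves the entry
  at \<open>2 ^ Suc j - 1\<close> to \<open>2 ^ j - 1\<close> and divides it by \<open>p\<close>;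
  the even part of \<open>h\<close> contributes at position 0 only. There the new entry is
  \<open>(h 1 + q h 0) / p\<close>, and \<open>source_coeff\<close> is chosen so that
  \<open>p * n\<close> becomes \<open>p * (n + 1)\<close>.\<close>

lemma renormalized_source:
  assumes "S v - c *\<^sub>C v = g" "\<And>n. ell1_nth g (2 ^ n - 1) = source_coeff c n"
    "\<And>k. \<forall>n. k \<noteq> 2 ^ n - 1 \<Longrightarrow> ell1_nth g k = 0"
  shows "\<exists>h. S ((even_part ^^ n) v) - (f ^^ n) c *\<^sub>C (even_part ^^ n) v = h
    \<and> ell1_nth h 0 = of_real p * of_nat n
    \<and> (\<forall>j\<ge>1. ell1_nth h (2 ^ j - 1) = source_coeff c (n + j) / of_real (p ^ n))
    \<and> (\<forall>k. (\<forall>j. k \<noteq> 2 ^ j - 1) \<longrightarrow> ell1_nth h k = 0)"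
proof (induction n)
  case 0
  show ?case
    using assms(1,3) assms(2)[of 0] assms(2) by (auto simp: source_coeff_def)
next
  case (Suc n)
  let ?w = "(even_part ^^ n) v" and ?a = "q ((f ^^ n) c)"
  from Suc obtain h where h: "S ?w - (f ^^ n) c *\<^sub>C ?w = h"
    and h0: "ell1_nth h 0 = of_real p * of_nat n"
    and hj: "\<And>j. j \<ge> 1 \<Longrightarrow> ell1_nth h (2 ^ j - 1) = source_coeff c (n + j) / of_real (p ^ n)"
    and hk: "\<And>k. \<forall>j. k \<noteq> 2 ^ j - 1 \<Longrightarrow> ell1_nth h k = 0"
    by blast
  let ?h = "(1 / of_real p) *\<^sub>C (odd_part h + ?a *\<^sub>C even_part h)"
  have nth: "ell1_nth ?h k = (ell1_nth h (2 * k + 1) + ?a * ell1_nth h (2 * k)) / of_real p" for k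
    by (simp add: scaleC_ell1.rep_eq plus_ell1.rep_eq odd_part.rep_eq even_part.rep_eq)
  \<comment> \<open>The support lies in the numbers \<open>2 ^ j - 1\<close>, of which only 0 is
    even.\<close>
  have h_even: "ell1_nth h (2 * k) = 0" if "k \<noteq> 0" for k
  proof (rule hk, intro allI notI)
    fix j assume "2 * k = 2 ^ j - 1"
    with that show False
      by (cases j) (simp_all, presburger)
  qed
  have "S ((even_part ^^ Suc n) v) - (f ^^ Suc n) c *\<^sub>C (even_part ^^ Suc n) v = ?h"
    using resolvent_eq_iff_parts[THEN iffD1, OF h] by simp
  moreover have "ell1_nth ?h 0 = of_real p * of_nat (Suc n)"
    using p_pos hj[of 1]
    by (simp add: nth h0 source_coeff_def diff_divide_distrib)
  moreover have "ell1_nth ?h (2 ^ j - 1) = source_coeff c (Suc n + j) / of_real (p ^ Suc n)"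
    if "j \<ge> 1" for j
  proof -
    have "2 ^ j - 1 \<noteq> (0 :: nat)"
      using that one_less_power[of "2 :: nat" j] by simp
    then have z: "ell1_nth h (2 * (2 ^ j - 1)) = 0"
      by (rule h_even)
    have e: "2 * (2 ^ j - 1) + 1 = 2 ^ Suc j - (1 :: nat)"
      using one_le_power[of "2 :: nat" j] unfolding power_Suc by linarith
    have "ell1_nth ?h (2 ^ j - 1) = (ell1_nth h (2 ^ Suc j - 1) + ?a * 0) / of_real p"
      by (simp only: nth e z)
    with hj[of "Suc j"] show ?thesis
      by simp
  qed
  moreover have "ell1_nth ?h k = 0" if k: "\<forall>j. k \<noteq> 2 ^ j - 1" for k
  proof -
    have "k \<noteq> 0"
      using k[rule_format, of 0] by simp
    moreover have "ell1_nth h (2 * k + 1) = 0"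
    proof (rule hk, intro allI notI)
      fix j assume "2 * k + 1 = 2 ^ j - 1"
      then obtain i where "2 * k + 1 = 2 ^ Suc i - 1"
        by (cases j) auto
      then have "k = 2 ^ i - 1"
        using one_le_power[of "2 :: nat" i] unfolding power_Suc by linarith
      with k show False by blast
    qed
    ultimately show ?thesis
      by (simp add: nth h_even)
  qed
  ultimately show ?case by blast
qed

lemma not_surj_resolvent:
  assumes "c \<in> filled_julia f"
  shows "\<not> surj (\<lambda>v. S v - c *\<^sub>C v)"
proof
  assume surj: "surj (\<lambda>v. S v - c *\<^sub>C v)"
  obtain g where g: "\<And>n. ell1_nth g (2 ^ n - 1) = source_coeff c n"
    "\<And>k. \<forall>n. k \<noteq> 2 ^ n - 1 \<Longrightarrow> ell1_nth g k = 0"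
    using exists_source[OF assms] by blast
  obtain v where v: "S v - c *\<^sub>C v = g"
    using surjD[OF surj, of g] by auto
  obtain Q where Q: "\<And>n. cmod (q ((f ^^ n) c)) \<le> Q"
    using bounded_affine_orbit[OF assms] by metis
  have "ell1_nth v (2 ^ n) = q ((f ^^ n) c) * ell1_nth v 0 + of_nat n" for n
  proof -
    let ?w = "(even_part ^^ n) v"
    obtain h where h: "S ?w - (f ^^ n) c *\<^sub>C ?w = h" "ell1_nth h 0 = of_real p * of_nat n"
      using renormalized_source[OF v g] by blast
    \<comment> \<open>At index 0 the left side is entry 1 of \<open>?w\<close>, that is
      \<open>v (2 ^ n)\<close>, and the source term is \<open>h 0 / p = n\<close>.\<close>
    have "odd_part ?w = q ((f ^^ n) c) *\<^sub>C even_part ?w + (1 / of_real p) *\<^sub>C even_part h"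
      using resolvent_eq_iff_parts[THEN iffD1, OF h(1)] by (rule conjunct1)
    from arg_cong[OF this, of "\<lambda>u. ell1_nth u 0"] show ?thesis
      using p_pos by (simp add: odd_part.rep_eq even_part.rep_eq plus_ell1.rep_eq
          scaleC_ell1.rep_eq h(2) funpow_even_part_nth)
  qed
  then have v_power2: "ell1_nth v (2 ^ n) - q ((f ^^ n) c) * ell1_nth v 0 = of_nat n" for n
    by (simp only: add_diff_cancel_left')
  have "real n \<le> norm v + Q * norm v" for n
  proof -
    have "real n = cmod (ell1_nth v (2 ^ n) - q ((f ^^ n) c) * ell1_nth v 0)"
      by (simp only: v_power2 norm_of_nat)
    also have "\<dots> \<le> cmod (ell1_nth v (2 ^ n)) + cmod (q ((f ^^ n) c)) * cmod (ell1_nth v 0)"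
      by (metis norm_mult norm_triangle_ineq4)
    also have "\<dots> \<le> norm v + Q * norm v"
      using order_trans[OF norm_ge_zero Q]
      by (intro add_mono mult_mono norm_ell1_nth_le Q) auto
    finally show ?thesis .
  qed
  then show False
    using reals_Archimedean2 not_less by blast
qed

section \<open>Ranges that are not dense\<close>

text \<open>Such a functional is an eigenvector of the adjoint of \<open>S\<close>. Complex
  homogeneity is a separate clause since \<open>bounded_linear\<close> expresses only real
  linearity.\<close>

definition has_left_eigenfunctional :: "complex \<Rightarrow> bool" where
  "has_left_eigenfunctional c \<longleftrightarrow> (\<exists>\<phi> :: ell1 \<Rightarrow> complex. bounded_linear \<phi>
     \<and> (\<forall>a v. \<phi> (a *\<^sub>C v) = a * \<phi> v) \<and> (\<forall>v. \<phi> (S v) = c * \<phi> v) \<and> (\<exists>v. \<phi> v \<noteq> 0))"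

text \<open>The kernel of the functional is closed, contains the range and misses
  \<open>w\<close>.\<close>

lemma range_not_dense:
  assumes "has_left_eigenfunctional c"
  shows "closure (range (\<lambda>v. S v - c *\<^sub>C v)) \<noteq> UNIV"
proof -
  obtain \<phi> :: "ell1 \<Rightarrow> complex" and w where \<phi>: "bounded_linear \<phi>"
    "\<And>a v. \<phi> (a *\<^sub>C v) = a * \<phi> v" "\<And>v. \<phi> (S v) = c * \<phi> v" "\<phi> w \<noteq> 0"
    using assms unfolding has_left_eigenfunctional_def by blast
  interpret \<phi>: bounded_linear \<phi> by fact
  have "closed (\<phi> -` {0})"
    by (intro continuous_closed_vimage closed_singleton \<phi>.continuous continuous_ident)
  moreover have "range (\<lambda>v. S v - c *\<^sub>C v) \<subseteq> \<phi> -` {0}"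
    by (auto simp: \<phi>.diff \<phi>(2,3))
  ultimately have "closure (range (\<lambda>v. S v - c *\<^sub>C v)) \<subseteq> \<phi> -` {0}"
    by (rule closure_minimal[rotated])
  with \<phi>(4) show ?thesis by blast
qed

text \<open>In terms of the values of \<phi> on the even and the odd part, \<open>q(S)\<close> acts
  as the matrix with rows \<open>(0, 1)\<close> and \<open>(f c, 0)\<close>. Its left eigenvector
  for the eigenvalue \<open>q c\<close> is \<open>(q c, 1)\<close>, which gives
  \<open>?\<psi>\<close>.\<close>

lemma left_eigenfunctional_of_quad_map:
  assumes "has_left_eigenfunctional (f c)"
  shows "has_left_eigenfunctional c"
proof -
  obtain \<phi> :: "ell1 \<Rightarrow> complex" and w where \<phi>: "bounded_linear \<phi>"
    "\<And>a v. \<phi> (a *\<^sub>C v) = a * \<phi> v" "\<And>v. \<phi> (S v) = f c * \<phi> v" "\<phi> w \<noteq> 0"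
    using assms unfolding has_left_eigenfunctional_def by blast
  interpret \<phi>: bounded_linear \<phi> by fact
  let ?\<psi> = "\<lambda>v. q c * \<phi> (even_part v) + \<phi> (odd_part v)"
  have c: "c = 1 - of_real p + of_real p * q c"
    using p_pos by (simp add: affine_part_def)
  have "bounded_linear ?\<psi>"
    by (intro bounded_linear_add bounded_linear_const_mult
        bounded_linear_compose[OF \<phi>(1) bounded_linear_even_part]
        bounded_linear_compose[OF \<phi>(1) bounded_linear_odd_part])
  moreover have "?\<psi> (a *\<^sub>C v) = a * ?\<psi> v" for a v
    by (simp add: \<phi>(2) algebra_simps)
  moreover have "?\<psi> (S v) = c * ?\<psi> v" for v
  proof -
    have "?\<psi> (S v) = (1 - of_real p + of_real p * q c) * ?\<psi> v"
      by (simp add: even_part_S odd_part_S \<phi>.add \<phi>(2,3) quad_map_def algebra_simps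
          power2_eq_square)
    then show ?thesis
      using c by simp
  qed
  moreover have "?\<psi> (interleave 0 w) \<noteq> 0"
    using \<phi>(4) by (simp add: \<phi>.zero)
  ultimately show ?thesis
    unfolding has_left_eigenfunctional_def by (intro exI[of _ ?\<psi>] conjI allI exI)
qed

section \<open>The invariant functional at 1\<close>

definition total :: "ell1 \<Rightarrow> complex" where
  "total v = (\<Sum>n. ell1_nth v n)"

lemma summable_nth: "summable (ell1_nth v)"
  using summable_ell1_nth by (rule summable_norm_cancel)

lemma total_scaleC: "total (a *\<^sub>C v) = a * total v"
  by (simp add: total_def scaleC_ell1.rep_eq suminf_mult summable_nth)

lemma total_add: "total (v + w) = total v + total w"
  by (simp add: total_def plus_ell1.rep_eq suminf_add summable_nth)

lemma cmod_total_le: "cmod (total v) \<le> norm v"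
  unfolding total_def norm_ell1.rep_eq by (rule summable_norm[OF summable_ell1_nth])

lemma bounded_linear_total: "bounded_linear total"
proof (rule bounded_linear_intro[where K = 1])
  show "total (r *\<^sub>R v) = r *\<^sub>R total v" for r v
    using total_scaleC[of "of_real r" v] by (simp add: scaleC_of_real scaleR_conv_of_real)
qed (simp_all add: total_add cmod_total_le)

lemma total_parts: "total v = total (even_part v) + total (odd_part v)"
proof -
  have "(\<lambda>k. \<Sum>n = k * 2..<k * 2 + 2. ell1_nth v n) sums total v"
    unfolding total_def by (intro sums_group summable_sums summable_nth) simp
  moreover have "(\<Sum>n = k * 2..<k * 2 + 2. ell1_nth v n)
      = ell1_nth (even_part v) k + ell1_nth (odd_part v) k" for k
    by (simp add: even_part.rep_eq odd_part.rep_eq numeral_2_eq_2 mult.commute)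
  ultimately have "(\<lambda>k. ell1_nth (even_part v) k + ell1_nth (odd_part v) k) sums total v"
    by simp
  moreover have "(\<lambda>k. ell1_nth (even_part v) k + ell1_nth (odd_part v) k)
      sums (total (even_part v) + total (odd_part v))"
    unfolding total_def by (intro sums_add summable_sums summable_nth)
  ultimately show ?thesis
    by (rule sums_unique2)
qed

text \<open>The defect \<open>total (S v) - total v\<close> is contracted by the factor \<open>p\<close> under passage to the
  even part, which avoids summing the columns of the matrix.\<close>

lemma total_S: "total (S v) = total v"
proof -
  \<comment> \<open>The odd part enters \<open>S v\<close> with the weights \<open>p\<close> and
    \<open>1 - p\<close>, so its total cancels.\<close>
  have step: "total (S v) - total v = of_real p * (total (S (even_part v)) - total (even_part v))"
    for v
    using total_parts[of v] total_parts[of "S v"]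
    by (simp add: even_part_S odd_part_S total_add total_scaleC algebra_simps)
  have iter: "total (S v) - total v
      = of_real (p ^ n) * (total (S ((even_part ^^ n) v)) - total ((even_part ^^ n) v))" for n
  proof (induction n)
    case (Suc n)
    then show ?case
      using step[of "(even_part ^^ n) v"] by simp
  qed simp
  have le: "norm ((even_part ^^ n) v) \<le> norm v" for n
    by (induction n) (auto intro: order_trans[OF norm_even_part_le])
  have "cmod (total (S v) - total v) \<le> p ^ n * (3 * norm v)" for n
  proof -
    let ?w = "(even_part ^^ n) v"
    have "cmod (total (S ?w) - total ?w) \<le> norm (S ?w) + norm ?w"
      using norm_triangle_ineq4[of "total (S ?w)" "total ?w"] cmod_total_le[of "S ?w"]
        cmod_total_le[of ?w] by linarith
    also have "\<dots> \<le> 3 * norm v"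
      using norm_adding_machine_le[OF p_pos p_less_1, of ?w] le[of n] by linarith
    finally show ?thesis
      using p_pos by (subst iter[of n]) (simp add: norm_mult norm_power)
  qed
  moreover have "(\<lambda>n. p ^ n * (3 * norm v)) \<longlonglongrightarrow> 0 * (3 * norm v)"
    using p_pos p_less_1 by (intro tendsto_intros LIMSEQ_power_zero) auto
  ultimately have "cmod (total (S v) - total v) \<le> 0"
    by (intro LIMSEQ_le_const[where X = "\<lambda>n. p ^ n * (3 * norm v)"]) auto
  then show ?thesis by simp
qed

lemma left_eigenfunctional_1: "has_left_eigenfunctional 1"
proof -
  let ?e = "\<lambda>n. if n = 0 then 1 else (0 :: complex)"
  have "summable (\<lambda>n. cmod (?e n))"
    by (rule summable_finite[of "{0}"]) auto
  then have "total (Abs_ell1 ?e) = (\<Sum>n. ?e n)"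
    by (simp add: total_def Abs_ell1_inverse)
  also have "\<dots> = 1"
    using suminf_finite[of "{0}" ?e] by simp
  finally have "total (Abs_ell1 ?e) \<noteq> 0" by simp
  then show ?thesis
    unfolding has_left_eigenfunctional_def
    using bounded_linear_total total_scaleC total_S by (intro exI[of _ total]) auto
qed

lemma left_eigenfunctional_preimage:
  assumes "(f ^^ n) c = 1"
  shows "has_left_eigenfunctional c"
proof -
  have "has_left_eigenfunctional ((f ^^ n) c)"
    using assms left_eigenfunctional_1 by simp
  then show ?thesis
    by (induction n) (simp_all add: left_eigenfunctional_of_quad_map)
qed

section \<open>The Julia set\<close>

lemma quad_map_in_filled_julia_iff: "f z \<in> filled_julia f \<longleftrightarrow> z \<in> filled_julia f"
proof -
  have "range (\<lambda>n. (f ^^ n) z) = insert z (range (\<lambda>n. (f ^^ n) (f z)))"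
    by (subst UNIV_nat_eq) (simp add: image_image funpow_Suc_right del: funpow.simps(2))
  then show ?thesis
    by (simp add: filled_julia_def)
qed

lemma holomorphic_quad_map: "f holomorphic_on A"
  unfolding quad_map_def affine_part_def using p_pos by (intro holomorphic_intros) auto

lemma holomorphic_funpow_quad_map: "(f ^^ n) holomorphic_on A"
proof (induction n)
  case (Suc n)
  then show ?case
    using holomorphic_on_compose[OF Suc holomorphic_quad_map] by (simp only: funpow.simps)
qed (simp add: holomorphic_on_ident id_def)

lemma quad_map_1: "f 1 = 1"
  using p_pos by (simp add: quad_map_def affine_part_def)

lemma funpow_quad_map_1: "(f ^^ n) 1 = 1"
  by (induction n) (simp_all add: quad_map_1)

lemma open_quad_map_image:
  assumes "open U"
  shows "open (f ` U)"
proof (rule open_mapping_thm[OF holomorphic_quad_map[of UNIV]])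
  have "f (1 - of_real p) = 0"
    by (simp add: quad_map_def affine_part_def)
  then show "\<not> f constant_on UNIV"
    using quad_map_1 unfolding constant_on_def by (metis UNIV_I zero_neq_one)
qed (use assms in auto)

lemma quad_map_in_interior:
  assumes "z \<in> interior (filled_julia f)"
  shows "f z \<in> interior (filled_julia f)"
proof (rule interiorI)
  show "open (f ` interior (filled_julia f))"
    by (rule open_quad_map_image) simp
  show "f ` interior (filled_julia f) \<subseteq> filled_julia f"
    using interior_subset[of "filled_julia f"] by (auto simp: quad_map_in_filled_julia_iff)
qed (use assms in simp)

text \<open>With \<open>t = (y - 1) / p\<close> one has \<open>q y = 1 + t\<close>, hence
  \<open>f y - 1 = 2 * t + t\<^sup>2\<close>, which is at least \<open>2 * (y - 1)\<close> for real
  \<open>y \<ge> 1\<close>. The distance to the fixed point 1 therefore at least doubles at each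
  step.\<close>

lemma real_escapes:
  assumes "1 < x"
  shows "of_real x \<notin> filled_julia f"
proof
  assume "of_real x \<in> filled_julia f"
  then obtain B where B: "\<And>n. cmod ((f ^^ n) (of_real x)) \<le> B"
    unfolding filled_julia_def bounded_iff by auto
  have "\<exists>y. (f ^^ n) (of_real x) = of_real y \<and> 2 ^ n * (x - 1) \<le> y - 1" for n
  proof (induction n)
    case (Suc n)
    then obtain y where y: "(f ^^ n) (of_real x) = of_real y" "2 ^ n * (x - 1) \<le> y - 1"
      by blast
    have y1: "0 \<le> y - 1"
      using y(2) assms by (meson diff_ge_0_iff_ge less_imp_le mult_nonneg_nonneg order_trans
          zero_le_numeral zero_le_power)
    let ?y = "((y - (1 - p)) / p)\<^sup>2"
    have "2 * (y - 1) \<le> 2 * ((y - 1) / p)"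
      using y1 p_pos p_less_1 by (simp add: pos_le_divide_eq mult_left_le)
    also have "\<dots> \<le> 2 * ((y - 1) / p) + ((y - 1) / p)\<^sup>2"
      by simp
    also have "\<dots> = ?y - 1"
      using p_pos by (simp add: field_simps power2_eq_square)
    finally have "2 ^ Suc n * (x - 1) \<le> ?y - 1"
      using y(2) by simp
    moreover have "(f ^^ Suc n) (of_real x) = of_real ?y"
      by (simp add: y(1) quad_map_def affine_part_def)
    ultimately show ?case by blast
  qed (auto intro: exI[of _ x])
  then have "2 ^ n * (x - 1) \<le> B" for n
  proof -
    obtain y where y: "(f ^^ n) (of_real x) = of_real y" "2 ^ n * (x - 1) \<le> y - 1"
      using \<open>\<And>n. \<exists>y. _ n y\<close> by blast
    show ?thesis
      using B[of n] y by simp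
  qed
  moreover obtain n where "B / (x - 1) < 2 ^ n"
    using real_arch_pow[of 2] by auto
  ultimately show False
    using assms by (simp add: pos_divide_less_eq) (meson not_le)
qed

lemma one_not_in_interior: "1 \<notin> interior (filled_julia f)"
proof
  assume "1 \<in> interior (filled_julia f)"
  then obtain e where e: "0 < e" "ball 1 e \<subseteq> filled_julia f"
    unfolding mem_interior by blast
  have "cmod (1 - complex_of_real (1 + e / 2)) = e / 2"
    using e(1) by (simp add: norm_divide)
  then have "of_real (1 + e / 2) \<in> ball (1 :: complex) e"
    using e(1) unfolding mem_ball dist_norm by linarith
  then show False
    using e real_escapes[of "1 + e / 2"] by auto
qed

text \<open>Membership in the filled Julia set pulls back along \<open>f\<close>, and membership in
  its interior pushes forward by the open mapping theorem. The point 1 lies in the set but not in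
  its interior.\<close>

lemma preimages_subset_julia: "(\<Union>n. (f ^^ n) -` {1}) \<subseteq> julia f"
proof clarsimp
  fix n z assume z: "(f ^^ n) z = 1"
  have "1 \<in> filled_julia f"
    by (simp add: filled_julia_def funpow_quad_map_1)
  with z have "(f ^^ n) z \<in> filled_julia f" by simp
  then have "z \<in> filled_julia f"
    by (induction n) (auto simp: quad_map_in_filled_julia_iff)
  moreover have "z \<notin> interior (filled_julia f)"
  proof
    assume "z \<in> interior (filled_julia f)"
    then have "(f ^^ n) z \<in> interior (filled_julia f)"
      by (induction n) (auto simp: quad_map_in_interior)
    with z one_not_in_interior show False by simp
  qed
  ultimately show "z \<in> julia f"
    using closure_subset by (auto simp: julia_def frontier_def)
qed

lemma countable_preimages: "countable (\<Union>n. (f ^^ n) -` {1})"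
proof -
  have fin: "finite (f -` {w})" for w
  proof (rule finite_subset)
    show "f -` {w} \<subseteq> {1 - of_real p + of_real p * csqrt w, 1 - of_real p - of_real p * csqrt w}"
    proof
      fix z assume "z \<in> f -` {w}"
      then have "(q z)\<^sup>2 = (csqrt w)\<^sup>2"
        by (simp add: quad_map_def)
      then have "q z = csqrt w \<or> q z = - csqrt w"
        by (simp only: power2_eq_iff)
      moreover have "z = 1 - of_real p + of_real p * q z"
        using p_pos by (simp add: affine_part_def)
      ultimately show "z \<in> {1 - of_real p + of_real p * csqrt w, 1 - of_real p - of_real p * csqrt w}"
        by auto
    qed
  qed simp
  have "finite ((f ^^ n) -` {1})" for n
  proof (induction n)
    case (Suc n)
    have "(f ^^ Suc n) -` {1} = (\<Union>w\<in>(f ^^ n) -` {1}. f -` {w})"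
      by (auto simp: funpow_Suc_right simp del: funpow.simps)
    with Suc fin show ?case by (simp del: funpow.simps)
  qed simp
  then show ?thesis
    by (intro countable_UN) (auto intro: countable_finite)
qed

text \<open>Near a point whose orbit is bounded, Schottky's theorem bounds all iterates at once as soon
  as they omit the two preimages \<open>1\<close> and \<open>1 - 2p\<close> of \<open>1\<close>.\<close>

lemma cball_subset_filled_julia:
  assumes "0 < r" "z0 \<in> filled_julia f" "cball z0 r \<inter> (\<Union>n. (f ^^ n) -` {1}) = {}"
  shows "cball z0 (2 / 3 * r) \<subseteq> filled_julia f"
proof
  fix z assume z: "z \<in> cball z0 (2 / 3 * r)"
  obtain B where B: "\<And>n. cmod ((f ^^ n) z0) \<le> B"
    using assms(2) unfolding filled_julia_def bounded_iff by auto
  define P where "P = complex_of_real p"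
  have P: "P \<noteq> 0" "cmod P = p"
    using p_pos by (auto simp: P_def)
  \<comment> \<open>\<open>R\<close> bounds the rescaled iterates at the centre, and
    \<open>M\<close> is the bound of Schottky's theorem on the disc of radius
    \<open>2 / 3\<close>.\<close>
  define R where "R = (B + 1) / (2 * p)"
  define M where "M = exp (pi * exp (pi * (2 + 2 * R + 12 * (2 / 3) / (1 - 2 / 3))))"
  have bound: "cmod ((f ^^ n) z) \<le> 2 * p * M + 1" for n
  proof -
    \<comment> \<open>The rescaling carries the disc of radius \<open>r\<close> around
      \<open>z0\<close> to the unit disc and sends the omitted values \<open>1\<close> and
      \<open>1 - 2p\<close> to 0 and 1.\<close>
    define h where "h u = ((f ^^ n) (z0 + of_real r * u) - 1) / (- 2 * P)" for u
    have "h holomorphic_on cball 0 1"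
    proof -
      have "(f ^^ n) \<circ> (\<lambda>u. z0 + of_real r * u) holomorphic_on cball 0 1"
        by (intro holomorphic_on_compose holomorphic_intros holomorphic_funpow_quad_map)
      then show ?thesis
        unfolding h_def o_def using P by (intro holomorphic_intros) auto
    qed
    moreover have "cmod (h 0) \<le> R"
    proof -
      have "cmod (h 0) = cmod ((f ^^ n) z0 - 1) / (2 * p)"
        using P by (simp add: h_def norm_divide norm_mult)
      also have "\<dots> \<le> (B + 1) / (2 * p)"
        using p_pos B[of n] norm_triangle_ineq4[of "(f ^^ n) z0" 1]
        by (intro divide_right_mono) auto
      finally show ?thesis
        by (simp add: R_def)
    qed
    moreover have "\<not> (h u = 0 \<or> h u = 1)" if "u \<in> cball 0 1" for u
    proof -
      let ?x = "z0 + of_real r * u"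
      have "?x \<in> cball z0 r"
        using that assms(1) by (simp add: dist_norm norm_mult)
      then have *: "(f ^^ m) ?x \<noteq> 1" for m
        using assms(3) by blast
      have "(f ^^ n) ?x \<noteq> 1 - 2 * P"
      proof
        assume "(f ^^ n) ?x = 1 - 2 * P"
        \<comment> \<open>Since \<open>q (1 - 2p) = -1\<close>, the map \<open>f\<close> sends
          \<open>1 - 2p\<close> to 1.\<close>
        then have "(f ^^ Suc n) ?x = 1"
          using P by (simp add: quad_map_def affine_part_def P_def[symmetric])
        with *[of "Suc n"] show False by simp
      qed
      then show ?thesis
        using *[of n] P by (auto simp: h_def field_simps)
    qed
    moreover have "norm ((z - z0) / of_real r) \<le> 2 / 3"
      using z assms(1) by (simp add: norm_divide dist_norm norm_minus_commute field_simps)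
    ultimately have hM: "cmod (h ((z - z0) / of_real r)) \<le> M"
      unfolding M_def by (intro Schottky) auto
    have "(f ^^ n) z = - 2 * P * h ((z - z0) / of_real r) + 1"
      using P assms(1) by (simp add: h_def)
    then have "cmod ((f ^^ n) z) \<le> cmod (- 2 * P * h ((z - z0) / of_real r)) + cmod 1"
      by (metis norm_triangle_ineq)
    also have "\<dots> \<le> 2 * p * M + 1"
      using hM p_pos by (simp add: norm_mult P)
    finally show ?thesis .
  qed
  then show "z \<in> filled_julia f"
    unfolding filled_julia_def bounded_iff by blast
qed

lemma julia_subset_closure_preimages: "julia f \<subseteq> closure (\<Union>n. (f ^^ n) -` {1})"
proof
  fix w assume w: "w \<in> julia f"
  show "w \<in> closure (\<Union>n. (f ^^ n) -` {1})" (is "_ \<in> closure ?P")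
  proof (rule ccontr)
    assume "w \<notin> closure ?P"
    then obtain r where r: "0 < r" "ball w r \<inter> ?P = {}"
      unfolding closure_approachable by (force simp: dist_commute)
    have "w \<in> closure (filled_julia f)"
      using w by (simp add: julia_def frontier_def)
    \<comment> \<open>Schottky's theorem is applied around a point of the filled set near
      \<open>w\<close>. The radii fit: \<open>r / 3 + r / 2 < r\<close> keeps the disc clear of the
      preimages, and the resulting disc of radius \<open>2 / 3 * (r / 2) = r / 3\<close> still
      contains \<open>w\<close>.\<close>
    then obtain z0 where z0: "z0 \<in> filled_julia f" "dist z0 w < r / 3"
      using r(1) unfolding closure_approachable by (metis divide_pos_pos zero_less_numeral)
    have "cball z0 (r / 2) \<subseteq> ball w r"
    proof
      fix y assume "y \<in> cball z0 (r / 2)"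
      then show "y \<in> ball w r"
        using z0(2) r(1) dist_triangle[of w y z0] by (simp add: dist_commute)
    qed
    with r(2) have "cball z0 (r / 2) \<inter> ?P = {}"
      by blast
    then have "cball z0 (2 / 3 * (r / 2)) \<subseteq> filled_julia f"
      using r(1) z0(1) by (intro cball_subset_filled_julia) auto
    then have "ball z0 (r / 3) \<subseteq> filled_julia f"
      by (auto simp: subset_iff)
    then have "w \<in> interior (filled_julia f)"
      using z0(2) by (intro interiorI[of "ball z0 (r / 3)"]) auto
    with w show False
      by (simp add: julia_def frontier_def)
  qed
qed

end

theorem theorem2:
  fixes p :: real and f :: "complex \<Rightarrow> complex"
  assumes "0 < p" and "p < 1"
    and "\<And>z. f z = (z - (1 - of_real p))\<^sup>2 / (of_real p)\<^sup>2"
  shows "point_spectrum (adding_machine p) = {}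
    \<and> residual_spectrum (adding_machine p) \<noteq> {}
    \<and> countable (\<Union>n. (f ^^ n) -` {1})
    \<and> (\<Union>n. (f ^^ n) -` {1}) \<subseteq> julia f
    \<and> julia f \<subseteq> closure (\<Union>n. (f ^^ n) -` {1})
    \<and> (\<Union>n. (f ^^ n) -` {1}) \<subseteq> residual_spectrum (adding_machine p)
    \<and> continuous_spectrum (adding_machine p) = filled_julia f - residual_spectrum (adding_machine p)"
proof -
  interpret stochastic_adding_machine p
    using assms(1,2) by unfold_locales
  have f: "f = quad_map p"
    by (rule ext) (simp add: assms(3) quad_map_def affine_part_def power_divide)
  have residual: "(\<Union>n. (f ^^ n) -` {1}) \<subseteq> residual_spectrum (adding_machine p)"
    using left_eigenfunctional_preimage range_not_dense inj_resolvent
    by (auto simp: f residual_spectrum_def)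
  moreover have "1 \<in> (f ^^ 0) -` {1}"
    by simp
  ultimately have "residual_spectrum (adding_machine p) \<noteq> {}"
    by blast
  moreover have "point_spectrum (adding_machine p) = {}"
    by (simp add: point_spectrum_def inj_resolvent)
  \<comment> \<open>Injectivity holds for every \<open>c\<close>, and surjectivity fails exactly on
    the filled Julia set, so density of the range alone separates the two spectra; a range that is
    not dense is in particular not everything.\<close>
  moreover have "continuous_spectrum (adding_machine p)
      = filled_julia f - residual_spectrum (adding_machine p)"
    using surj_resolvent not_surj_resolvent inj_resolvent
    by (auto simp: f continuous_spectrum_def residual_spectrum_def)
  ultimately show ?thesis
    using residual countable_preimages preimages_subset_julia julia_subset_closure_preimages
    unfolding f by blast
qed

end
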